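(* For all non-negative integers $n,m,p,q$ and all complex numbers $z,w,\gamma,u,v$, $$\sum_{n=0}^\infty H_{n,m}^{(p,q)}(z,w|\gamma)\frac{u^{n}}{n!}=H_{m}^{(q)}(w|u^p\gamma)\,e^{zu},$$ $$\sum_{m=0}^\infty H_{n,m}^{(p,q)}(z,w|\gamma)\frac{v^{m}}{m!}=H_{n}^{(p)}(z|v^q\gamma)\,e^{wv},$$ $$\sum_{n=0}^\infty\sum_{m=0}^\infty H_{n,m}^{(p,q)}(z,w|\gamma)\frac{u^{n}v^{m}}{n!\,m!}=e^{zu+wv+\gamma u^{p}v^{q}}.$$
   Context: For non-negative integers $n,m,p,q$ and complex $z,w,\gamma$, $$H_{n,m}^{(p,q)}(z,w|\gamma)= n!\,m!\sum_{k=0}^{\lfloor n/p\rfloor\wedge\lfloor m/q\rfloor}\frac{\gamma^k}{k!}\frac{z^{n-pk}}{(n-pk)!}\frac{w^{m-qk}}{(m-qk)!},$$ where $a\wedge b=\min\{a,b\}$ and $\lfloor j/0\rfloor=+\infty$ by convention (so for $p=q=0$ the sum is the infinite series $e^{\gamma}z^nw^m$); $0^0=1$. The Gould--Hopper polynomials are $$H_{n}^{(p)}(z|\gamma)=n!\sum_{k=0}^{\lfloor n/p\rfloor}\frac{\gamma^k}{k!}\frac{z^{n-pk}}{(n-pk)!},$$ with the same convention (so $H_n^{(0)}(z|\gamma)=e^\gamma z^n$). *)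

theory Defs
  imports "HOL-Analysis.Infinite_Sum" "HOL-Library.Extended_Nat"
begin

definition floor_quot :: "nat \<Rightarrow> nat \<Rightarrow> enat" where
  "floor_quot j p = (if p = 0 then \<infinity> else enat (j div p))"

(* The index set is finite unless p = q = 0, in which case it is all of nat and infsum is the sum
   of the absolutely convergent exponential series. The natural-number subtractions never
   truncate on the index set. *)
definition H2 :: "nat \<Rightarrow> nat \<Rightarrow> nat \<Rightarrow> nat \<Rightarrow> complex \<Rightarrow> complex \<Rightarrow> complex \<Rightarrow> complex" where
  "H2 p q n m z w \<gamma> = fact n * fact m *
     (\<Sum>\<^sub>\<infinity>k\<in>{k. enat k \<le> min (floor_quot n p) (floor_quot m q)}.
        \<gamma> ^ k / fact k * (z ^ (n - p * k) / fact (n - p * k)) * (w ^ (m - q * k) / fact (m - q * k)))"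

definition gould_hopper :: "nat \<Rightarrow> nat \<Rightarrow> complex \<Rightarrow> complex \<Rightarrow> complex" where
  "gould_hopper p n z \<gamma> = fact n *
     (\<Sum>\<^sub>\<infinity>k\<in>{k. enat k \<le> floor_quot n p}.
        \<gamma> ^ k / fact k * (z ^ (n - p * k) / fact (n - p * k)))"

lemma infsum_exp: "(\<Sum>\<^sub>\<infinity>k. \<gamma> ^ k / fact k) = exp (\<gamma>::complex)"
proof -
  have "(\<lambda>k. \<gamma> ^ k / fact k) sums exp \<gamma>"
    using exp_converges[of \<gamma>] by (simp add: scaleR_conv_of_real divide_inverse mult.commute)
  moreover have "summable (\<lambda>k. norm (\<gamma> ^ k / fact k))"
    using summable_norm_exp[of \<gamma>] by (simp add: norm_mult norm_inverse norm_power divide_inverse mult.commute)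
  ultimately show ?thesis
    by (intro infsumI norm_summable_imp_has_sum)
qed

lemma H2_0_0: "H2 0 0 n m z w \<gamma> = exp \<gamma> * z ^ n * w ^ m"
proof -
  have "H2 0 0 n m z w \<gamma> = fact n * fact m *
      (\<Sum>\<^sub>\<infinity>k. \<gamma> ^ k / fact k * (z ^ n / fact n * (w ^ m / fact m)))"
    by (simp add: H2_def floor_quot_def mult.assoc)
  then show ?thesis
    by (simp only: infsum_cmult_left' infsum_exp) simp
qed

lemma gould_hopper_0: "gould_hopper 0 n z \<gamma> = exp \<gamma> * z ^ n"
proof -
  have "gould_hopper 0 n z \<gamma> = fact n * (\<Sum>\<^sub>\<infinity>k. \<gamma> ^ k / fact k * (z ^ n / fact n))"
    by (simp add: gould_hopper_def floor_quot_def)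
  then show ?thesis
    by (simp only: infsum_cmult_left' infsum_exp) simp
qed

lemma gould_hopper_pos:
  assumes "p > 0"
  shows "gould_hopper p n z \<gamma> =
    fact n * (\<Sum>k=0..n div p. \<gamma> ^ k / fact k * (z ^ (n - p * k) / fact (n - p * k)))"
proof -
  have "{k. enat k \<le> floor_quot n p} = {0..n div p}"
    using assms by (auto simp: floor_quot_def)
  then show ?thesis
    by (simp add: gould_hopper_def)
qed

lemma H2_pos:
  assumes "p > 0" "q > 0"
  shows "H2 p q n m z w \<gamma> = fact n * fact m *
    (\<Sum>k=0..min (n div p) (m div q).
       \<gamma> ^ k / fact k * (z ^ (n - p * k) / fact (n - p * k)) * (w ^ (m - q * k) / fact (m - q * k)))"
proof -
  have "{k. enat k \<le> min (floor_quot n p) (floor_quot m q)} = {0..min (n div p) (m div q)}"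
    using assms by (auto simp: floor_quot_def)
  then show ?thesis
    by (simp add: H2_def)
qed

end

(* Interchanging the sum over n with the sum over k turns the n-sum, after the shift n = j + p k,
   into a Cauchy product with the exponential series of z u; absolute convergence on the product
   index set justifies the interchange. The second identity follows from the symmetry
   (p, n, z) <-> (q, m, w), and the third by applying the same interchange to the Gould-Hopper
   polynomials which result from the inner sum of the double series. *)
theory Submission
  imports Defs
begin

text \<open>The form \<open>p * k \<le> n\<close> absorbs the convention for division by zero: at
  \<open>p = 0\<close> both sides hold for every \<open>k\<close>, so later arguments treat all
  \<open>p\<close> uniformly.\<close>

lemma le_floor_quot_iff: "enat k \<le> floor_quot n p \<longleftrightarrow> p * k \<le> n"
  by (cases "p = 0") (simp_all add: floor_quot_def less_eq_div_iff_mult_less_eq mult.commute)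

lemma abs_summable_exp: "(\<lambda>k. x ^ k / fact k :: complex) abs_summable_on UNIV"
  using summable_norm_exp[of x]
  by (intro norm_summable_imp_summable_on)
     (simp add: norm_divide norm_mult norm_inverse norm_power divide_inverse mult.commute)

lemma has_sum_exp_times:
  fixes b :: "nat \<Rightarrow> complex"
  assumes "b abs_summable_on K"
  shows "((\<lambda>(k, j). b k * (x ^ j / fact j)) has_sum infsum b K * exp x) (K \<times> UNIV)"
proof -
  have e: "((\<lambda>j. x ^ j / fact j) has_sum exp x) UNIV"
    using has_sum_infsum[OF abs_summable_summable[OF abs_summable_exp[of x]]] by (simp add: infsum_exp)
  have inner: "((\<lambda>j. case (k, j) of (k, j) \<Rightarrow> b k * (x ^ j / fact j)) has_sum b k * exp x) UNIV" for k
    using has_sum_cmult_right[OF e] by simp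
  have outer: "((\<lambda>k. b k * exp x) has_sum infsum b K * exp x) K"
    by (intro has_sum_cmult_left has_sum_infsum abs_summable_summable[OF assms])
  \<comment> \<open>Absolute summability gives the existence of the double sum; its value is then
    read off by summing over \<open>j\<close> first and using uniqueness of sums.\<close>
  have "(\<lambda>(k, j). b k * (x ^ j / fact j)) abs_summable_on K \<times> UNIV"
    unfolding abs_summable_on_Sigma_iff prod.case norm_mult infsum_cmult_right' real_norm_def abs_mult abs_norm_cancel
    by (intro conjI ballI summable_on_cmult_right summable_on_cmult_left assms abs_summable_exp)
  then have total: "((\<lambda>(k, j). b k * (x ^ j / fact j)) has_sum
      (\<Sum>\<^sub>\<infinity>(k, j)\<in>K \<times> UNIV. b k * (x ^ j / fact j))) (K \<times> UNIV)"
    by (rule has_sum_infsum[OF abs_summable_summable])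
  show ?thesis
    using total has_sum_unique[OF has_sum_Sigma'[OF total inner] outer] by simp
qed

text \<open>The weight \<open>u ^ (p * k)\<close> in the hypothesis is what remains of
  \<open>u ^ n\<close> once \<open>u ^ j\<close> has joined \<open>z ^ j\<close>. Keeping
  \<open>a\<close> and \<open>K\<close> general lets the lemma serve both \<open>H2\<close> and
  \<open>gould_hopper\<close>.\<close>

lemma shifted_exp_sums:
  fixes a :: "nat \<Rightarrow> complex"
  assumes "(\<lambda>k. a k * u ^ (p * k)) abs_summable_on K"
  shows "(\<lambda>n. (\<Sum>\<^sub>\<infinity>k\<in>{k\<in>K. p * k \<le> n}. a k * (z ^ (n - p * k) / fact (n - p * k))) * u ^ n)
           sums ((\<Sum>\<^sub>\<infinity>k\<in>K. a k * u ^ (p * k)) * exp (z * u))"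
proof -
  define f where "f n k = a k * (z ^ (n - p * k) / fact (n - p * k)) * u ^ n" for n k
  have "((\<lambda>(n, k). f n k) has_sum (\<Sum>\<^sub>\<infinity>k\<in>K. a k * u ^ (p * k)) * exp (z * u))
          (SIGMA n:UNIV. {k\<in>K. p * k \<le> n}) \<longleftrightarrow>
        ((\<lambda>(k, j). a k * u ^ (p * k) * ((z * u) ^ j / fact j)) has_sum
          (\<Sum>\<^sub>\<infinity>k\<in>K. a k * u ^ (p * k)) * exp (z * u)) (K \<times> UNIV)"
    \<comment> \<open>The maps are mutually inverse because \<open>p * k \<le> n\<close> on the left
      index set, so the subtraction is exact.\<close>
    by (rule has_sum_reindex_bij_witness[where i = "\<lambda>(k, j). (j + p * k, k)" and j = "\<lambda>(n, k). (k, n - p * k)"])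
       (auto simp: f_def power_mult_distrib simp flip: power_add)
  then have s: "((\<lambda>(n, k). f n k) has_sum (\<Sum>\<^sub>\<infinity>k\<in>K. a k * u ^ (p * k)) * exp (z * u))
          (SIGMA n:UNIV. {k\<in>K. p * k \<le> n})"
    using has_sum_exp_times[OF assms] by simp
  \<comment> \<open>For \<open>p = 0\<close> this set is all of \<open>K\<close>, possibly infinite,
    so summability is inherited from the double sum.\<close>
  have "f n summable_on {k\<in>K. p * k \<le> n}" for n
    using summable_on_SigmaD1[OF has_sum_imp_summable[OF s]] by simp
  then have "((\<lambda>n. infsum (f n) {k\<in>K. p * k \<le> n}) has_sum
      (\<Sum>\<^sub>\<infinity>k\<in>K. a k * u ^ (p * k)) * exp (z * u)) UNIV"
    by (intro has_sum_Sigma'[OF s]) simp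
  then show ?thesis
    unfolding f_def infsum_cmult_left' by (rule has_sum_imp_sums)
qed

lemma H2_commute: "H2 p q n m z w \<gamma> = H2 q p m n w z \<gamma>"
  by (simp add: H2_def min.commute mult_ac)

lemma H2_sums_left:
  "(\<lambda>n. H2 p q n m z w \<gamma> * (u ^ n / fact n)) sums (gould_hopper q m w (u ^ p * \<gamma>) * exp (z * u))"
proof -
  define K where "K = {k. q * k \<le> m}"
  \<comment> \<open>\<open>a k\<close> collects the factors free of \<open>n\<close> and
    \<open>z\<close>; the remaining \<open>fact n\<close> of \<open>H2\<close> cancels against
    \<open>u ^ n / fact n\<close>.\<close>
  define a where "a k = fact m * (\<gamma> ^ k / fact k * (w ^ (m - q * k) / fact (m - q * k)))" for k
  have a: "a k * u ^ (p * k) =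
      fact m * ((u ^ p * \<gamma>) ^ k / fact k * (w ^ (m - q * k) / fact (m - q * k)))" for k
    by (simp add: a_def power_mult_distrib power_mult)
  have "(\<lambda>k. a k * u ^ (p * k)) abs_summable_on K"
  \<comment> \<open>For \<open>q = 0\<close> the \<open>w\<close>-factor is constant in
    \<open>k\<close>, leaving an exponential series; otherwise \<open>K\<close> is finite.\<close>
  proof (cases "q = 0")
    case True
    then show ?thesis
      using abs_summable_exp[of "u ^ p * \<gamma>"]
      unfolding a K_def norm_mult by (auto intro!: summable_on_cmult_left summable_on_cmult_right)
  next
    case False
    then have "K \<subseteq> {..m}"
      unfolding K_def by (auto intro: order_trans[rotated])
    then show ?thesis
      by (auto intro!: summable_on_finite dest: finite_subset)
  qed
  from shifted_exp_sums[OF this, of z]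
  have "(\<lambda>n. (\<Sum>\<^sub>\<infinity>k\<in>{k\<in>K. p * k \<le> n}. a k * (z ^ (n - p * k) / fact (n - p * k))) * u ^ n)
      sums ((\<Sum>\<^sub>\<infinity>k\<in>K. a k * u ^ (p * k)) * exp (z * u))" .
  moreover have "(\<Sum>\<^sub>\<infinity>k\<in>K. a k * u ^ (p * k)) = gould_hopper q m w (u ^ p * \<gamma>)"
    unfolding a by (simp only: infsum_cmult_right' gould_hopper_def le_floor_quot_iff K_def)
  moreover have "(\<Sum>\<^sub>\<infinity>k\<in>{k\<in>K. p * k \<le> n}. a k * (z ^ (n - p * k) / fact (n - p * k))) * u ^ n =
      H2 p q n m z w \<gamma> * (u ^ n / fact n)" for n
  proof -
    have "(\<Sum>\<^sub>\<infinity>k\<in>{k\<in>K. p * k \<le> n}. a k * (z ^ (n - p * k) / fact (n - p * k))) =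
      (\<Sum>\<^sub>\<infinity>k\<in>{k. enat k \<le> min (floor_quot n p) (floor_quot m q)}. fact m *
        (\<gamma> ^ k / fact k * (z ^ (n - p * k) / fact (n - p * k)) * (w ^ (m - q * k) / fact (m - q * k))))"
      unfolding a_def
      by (rule infsum_cong_neutral) (auto simp: K_def le_floor_quot_iff field_simps)
    then show ?thesis
      unfolding infsum_cmult_right' H2_def by simp
  qed
  ultimately show ?thesis
    by simp
qed

text \<open>This is \<open>shifted_exp_sums\<close> with \<open>a k = \<gamma> ^ k / fact k\<close>
  on all of the naturals, where the weighted sum is the exponential series of
  \<open>\<gamma> * u ^ p\<close>.\<close>

lemma gould_hopper_sums:
  "(\<lambda>n. gould_hopper p n z \<gamma> * (u ^ n / fact n)) sums exp (z * u + \<gamma> * u ^ p)"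
proof -
  have e: "\<gamma> ^ k / fact k * u ^ (p * k) = (\<gamma> * u ^ p) ^ k / fact k" for k
    by (simp add: power_mult_distrib power_mult)
  have "(\<lambda>k. \<gamma> ^ k / fact k * u ^ (p * k)) abs_summable_on UNIV"
    unfolding e by (rule abs_summable_exp)
  from shifted_exp_sums[OF this, of z, unfolded e infsum_exp] show ?thesis
    by (simp add: gould_hopper_def le_floor_quot_iff exp_add mult.commute[of "exp (z * u)"])
qed

theorem proposition3p1:
  fixes p q :: nat and z w \<gamma> u v :: complex
  shows "(\<forall>m. (\<lambda>n. H2 p q n m z w \<gamma> * (u ^ n / fact n))
            sums (gould_hopper q m w (u ^ p * \<gamma>) * exp (z * u)))
    \<and> (\<forall>n. (\<lambda>m. H2 p q n m z w \<gamma> * (v ^ m / fact m))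
            sums (gould_hopper p n z (v ^ q * \<gamma>) * exp (w * v)))
    \<and> (\<forall>n. summable (\<lambda>m. H2 p q n m z w \<gamma> * (u ^ n * v ^ m / (fact n * fact m))))
    \<and> (\<lambda>n. \<Sum>m. H2 p q n m z w \<gamma> * (u ^ n * v ^ m / (fact n * fact m)))
            sums exp (z * u + w * v + \<gamma> * u ^ p * v ^ q)"
proof -
  have right: "(\<lambda>m. H2 p q n m z w \<gamma> * (v ^ m / fact m))
      sums (gould_hopper p n z (v ^ q * \<gamma>) * exp (w * v))" for n
    using H2_sums_left[of q p n w z \<gamma> v] by (simp add: H2_commute[of p q])
  have inner: "(\<lambda>m. H2 p q n m z w \<gamma> * (u ^ n * v ^ m / (fact n * fact m)))
      sums (gould_hopper p n z (v ^ q * \<gamma>) * (u ^ n / fact n) * exp (w * v))" for n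
    using sums_mult[OF right[of n], of "u ^ n / fact n"] by (simp add: mult_ac)
  \<comment> \<open>The factor \<open>exp (w * v)\<close> does not depend on \<open>n\<close>, so
    only the Gould-Hopper series with parameter \<open>v ^ q * \<gamma>\<close> remains.\<close>
  have "(\<lambda>n. gould_hopper p n z (v ^ q * \<gamma>) * (u ^ n / fact n) * exp (w * v))
      sums exp (z * u + w * v + \<gamma> * u ^ p * v ^ q)"
    using sums_mult2[OF gould_hopper_sums[of p z "v ^ q * \<gamma>" u], of "exp (w * v)"]
    by (simp add: add_ac mult_ac flip: exp_add)
  then show ?thesis
    using H2_sums_left right inner by (auto simp: sums_iff)
qed

end
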